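(* Let $0 \le \Delta < 1$ and $a > 0$, and let $\eta_t = \{l_t, r_t\}$ be the two-point linear edge-reinforced process on $\mathbb{Z}$ with drift $\Delta$ and initial edge weight $a$, started from $l_0 < r_0$ (as described in the context). Then $(r_t - l_t)$ is recurrent: almost surely the two particles meet infinitely often, i.e. the set $\{t \ge 0 : l_t = r_t\}$ is almost surely unbounded.
   Context: The two-point linear edge-reinforced process on $\mathbb{Z}$ with drift $\Delta \ge 0$ and initial weight $a>0$ is defined as follows. Every edge $[v,v+1]$, $v\in\mathbb{Z}$, carries a weight $W_t(v,v+1)$, with $W_0(v,v+1)=a$ for all $v$. Two particles move on $\mathbb{Z}$; each carries an independent rate-one exponential clock (independent exponential waiting times with rate one between its jumps). When the clock of a particle located at site $v$ rings at time $t$, the particle jumps to $v+1$ with probability $$\frac{W_{t-}(v,v+1)+\Delta}{W_{t-}(v-1,v)+W_{t-}(v,v+1)+\Delta}$$ and to $v-1$ with probability $$\frac{W_{t-}(v-1,v)}{W_{t-}(v-1,v)+W_{t-}(v,v+1)+\Delta},$$ and the weight of the traversed edge is increased by $1$ (all other weights unchanged). The weights are shared by both particles. Denote by $l_t$ the position of the left particle and by $r_t$ that of the right particle at time $t$ (so $l_t \le r_t$; when $l_t=r_t$ the labels are immaterial). *)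

theory Defs
  imports "HOL-Probability.Probability"
begin

text \<open>
Explicit construction of the two-point linear edge-reinforced process.
The randomness is an i.i.d. stream of triples (X_j, Y_j, U_j), with X_j, Y_j ~ Exp(1)
and U_j ~ Uniform[0,1], all independent.  Particle A (started at l0) has clock ring times
X_0, X_0+X_1, ...; particle B (started at r0) has ring times Y_0, Y_0+Y_1, ...
The n-th jump of the superposed process uses U_n to decide the direction.
Edge [v,v+1] has weight W v.
\<close>

definition exp1 :: "real measure" where
  "exp1 = density lborel (\<lambda>x. ennreal (exponential_density 1 x))"

definition unif01 :: "real measure" where
  "unif01 = uniform_measure lborel {0..1}"

definition errw_space :: "(real \<times> real \<times> real) stream measure" where
  "errw_space = stream_space (exp1 \<Otimes>\<^sub>M (exp1 \<Otimes>\<^sub>M unif01))"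

type_synonym errw_input = "(real \<times> real \<times> real) stream"

definition ringA :: "errw_input \<Rightarrow> nat \<Rightarrow> real" where
  "ringA \<omega> k = (\<Sum>j\<le>k. fst (\<omega> !! j))"

definition ringB :: "errw_input \<Rightarrow> nat \<Rightarrow> real" where
  "ringB \<omega> k = (\<Sum>j\<le>k. fst (snd (\<omega> !! j)))"

definition unifU :: "errw_input \<Rightarrow> nat \<Rightarrow> real" where
  "unifU \<omega> n = snd (snd (\<omega> !! n))"

record errw_state =
  posA :: int
  posB :: int
  wt :: "int \<Rightarrow> real"
  cntA :: nat
  cntB :: nat
  jtime :: real

definition move :: "real \<Rightarrow> (int \<Rightarrow> real) \<Rightarrow> int \<Rightarrow> real \<Rightarrow> int \<times> (int \<Rightarrow> real)" where
  "move \<Delta> W v u =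
     (if u < (W v + \<Delta>) / (W (v - 1) + W v + \<Delta>)
      then (v + 1, W(v := W v + 1))
      else (v - 1, W(v - 1 := W (v - 1) + 1)))"

definition errw_step :: "real \<Rightarrow> errw_input \<Rightarrow> nat \<Rightarrow> errw_state \<Rightarrow> errw_state" where
  "errw_step \<Delta> \<omega> n s =
     (let tA = ringA \<omega> (cntA s); tB = ringB \<omega> (cntB s) in
      if tA \<le> tB then
        (let (v', W') = move \<Delta> (wt s) (posA s) (unifU \<omega> n) in
          s\<lparr>posA := v', wt := W', cntA := Suc (cntA s), jtime := tA\<rparr>)
      else
        (let (v', W') = move \<Delta> (wt s) (posB s) (unifU \<omega> n) in
          s\<lparr>posB := v', wt := W', cntB := Suc (cntB s), jtime := tB\<rparr>))"

primrec errw_chain :: "real \<Rightarrow> real \<Rightarrow> int \<Rightarrow> int \<Rightarrow> errw_input \<Rightarrow> nat \<Rightarrow> errw_state" where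
  "errw_chain \<Delta> a l0 r0 \<omega> 0 =
     \<lparr>posA = l0, posB = r0, wt = (\<lambda>_. a), cntA = 0, cntB = 0, jtime = 0\<rparr>"
| "errw_chain \<Delta> a l0 r0 \<omega> (Suc n) =
     errw_step \<Delta> \<omega> n (errw_chain \<Delta> a l0 r0 \<omega> n)"

definition errw_at :: "real \<Rightarrow> real \<Rightarrow> int \<Rightarrow> int \<Rightarrow> errw_input \<Rightarrow> real \<Rightarrow> errw_state" where
  "errw_at \<Delta> a l0 r0 \<omega> t =
     errw_chain \<Delta> a l0 r0 \<omega> (LEAST n. t < jtime (errw_chain \<Delta> a l0 r0 \<omega> (Suc n)))"

definition lpos :: "real \<Rightarrow> real \<Rightarrow> int \<Rightarrow> int \<Rightarrow> errw_input \<Rightarrow> real \<Rightarrow> int" where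
  "lpos \<Delta> a l0 r0 \<omega> t =
     min (posA (errw_at \<Delta> a l0 r0 \<omega> t)) (posB (errw_at \<Delta> a l0 r0 \<omega> t))"

definition rpos :: "real \<Rightarrow> real \<Rightarrow> int \<Rightarrow> int \<Rightarrow> errw_input \<Rightarrow> real \<Rightarrow> int" where
  "rpos \<Delta> a l0 r0 \<omega> t =
     max (posA (errw_at \<Delta> a l0 r0 \<omega> t)) (posB (errw_at \<Delta> a l0 r0 \<omega> t))"

end

theory Submission
  imports Defs
begin

text \<open>
Condition on the clocks, so that the order in which the particles jump is a fixed sequence. While the
left particle is at $x$ and the right one at $y > x$, consider the resistance
$F = \sum_{x \le v < y} 1/W(v)$ of the gap. An inward jump over an edge of weight $w$ subtracts $1/w$,
an outward one adds only $1/(w+1)$, since the edge is reinforced by the jump. For $\Delta < 1$ this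
makes $F$ a nonnegative supermartingale until the particles meet, whichever particle jumps, so on the
event that they never meet the sum of its drifts is almost surely finite.

An outward jump over an untraversed edge costs a fixed amount of drift, so eventually there are none,
and both particles stay in a finite interval. Let $v$ be the upper limit of the position of the right
particle. The weight of $[v,v+1]$ is eventually constant while that of $[v-1,v]$ grows by exactly $2$
per visit of $v$, so the drifts collected at $v$ dominate a harmonic series: a contradiction.
\<close>

section \<open>Streams of independent pairs\<close>

lemma (in prob_space) emeasure_scylinder:
  assumes "\<forall>A\<in>set As. A \<in> sets M"
  shows "emeasure (stream_space M) (scylinder (space M) As) = (\<Prod>A\<leftarrow>As. emeasure M A)"
  using assms
proof (induction As)
  case Nil
  interpret S: prob_space "stream_space M" by (rule prob_space_stream_space)
  show ?case using S.emeasure_space_1 by (simp add: space_stream_space)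
next
  case (Cons A As)
  then have [measurable]: "A \<in> sets M" by simp
  have "emeasure (stream_space M) (scylinder (space M) (A # As)) =
      (\<integral>\<^sup>+t. indicator A t * emeasure (stream_space M) (scylinder (space M) As) \<partial>M)"
    using scylinder_streams[of "space M" As] Cons.prems
    by (subst emeasure_stream_space, intro sets_scylinder)
      (auto simp: space_stream_space streams_Stream split: split_indicator intro!: nn_integral_cong arg_cong[where f="emeasure _"])
  also have "\<dots> = emeasure M A * emeasure (stream_space M) (scylinder (space M) As)"
    by (simp add: nn_integral_multc)
  finally show ?case using Cons by simp
qed

text \<open>Cylinders over measurable rectangles form a generating family, since rectangles are
  stable under intersection. On such a cylinder both measures equal the product of the coordinate
  probabilities, because a zipped stream lies in it exactly when each component stream lies in its
  own cylinder.\<close>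

lemma stream_space_pair:
  assumes M: "prob_space M" and N: "prob_space N"
  shows "distr (stream_space M \<Otimes>\<^sub>M stream_space N) (stream_space (M \<Otimes>\<^sub>M N)) (\<lambda>(x, y). szip x y)
    = stream_space (M \<Otimes>\<^sub>M N)"
proof -
  interpret M: prob_space M by fact
  interpret N: prob_space N by fact
  interpret MN: pair_prob_space M N ..
  interpret SM: prob_space "stream_space M" by (rule M.prob_space_stream_space)
  interpret SN: prob_space "stream_space N" by (rule N.prob_space_stream_space)
  interpret SMN: pair_prob_space "stream_space M" "stream_space N" ..
  let ?G = "{A \<times> B | A B. A \<in> sets M \<and> B \<in> sets N}"
  have dom: "scylinder (space (M \<Otimes>\<^sub>M N)) Cs \<in> sets (stream_space (M \<Otimes>\<^sub>M N))"
    if "Cs \<in> lists ?G" for Cs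
    by (rule sets_scylinder) (use that in auto)
  have *: "emeasure (distr (stream_space M \<Otimes>\<^sub>M stream_space N) (stream_space (M \<Otimes>\<^sub>M N))
         (\<lambda>(x, y). szip x y)) (scylinder (space (M \<Otimes>\<^sub>M N)) Cs)
      = emeasure (stream_space (M \<Otimes>\<^sub>M N)) (scylinder (space (M \<Otimes>\<^sub>M N)) Cs)"
    if Cs: "Cs \<in> lists ?G" for Cs
  proof -
    have "\<exists>As Bs. length As = length Bs \<and> (\<forall>A\<in>set As. A \<in> sets M) \<and> (\<forall>B\<in>set Bs. B \<in> sets N)
      \<and> Cs = map2 (\<times>) As Bs"
      using Cs
    proof induction
      case Nil show ?case by (intro exI[of _ "[]"]) simp
    next
      case (Cons C Cs)
      then obtain As Bs A B where "length As = length Bs" "\<forall>A\<in>set As. A \<in> sets M" "\<forall>B\<in>set Bs. B \<in> sets N"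
        "Cs = map2 (\<times>) As Bs" "C = A \<times> B" "A \<in> sets M" "B \<in> sets N" by blast
      then show ?case by (intro exI[of _ "A # As"] exI[of _ "B # Bs"]) auto
    qed
    then obtain As Bs where AB: "length As = length Bs" "\<forall>A\<in>set As. A \<in> sets M"
      "\<forall>B\<in>set Bs. B \<in> sets N" "Cs = map2 (\<times>) As Bs" by blast
    have "x \<in> streams (space M) \<Longrightarrow> y \<in> streams (space N) \<Longrightarrow>
      szip x y \<in> scylinder (space (M \<Otimes>\<^sub>M N)) (map2 (\<times>) As Bs) \<longleftrightarrow>
        x \<in> scylinder (space M) As \<and> y \<in> scylinder (space N) Bs" for x y
      using AB(1)
    proof (induction As Bs arbitrary: x y rule: list_induct2)
      case Nil then show ?case by (auto simp: space_pair_measure streams_iff_snth)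
    next
      case (Cons A As B Bs)
      moreover have "szip x y \<in> streams (space M \<times> space N)"
        using Cons.prems by (simp add: streams_iff_snth)
      ultimately show ?case using Cons.IH[OF streams_stl streams_stl, of x y]
        by (auto simp: space_pair_measure)
    qed
    then have "(\<lambda>(x, y). szip x y) -` scylinder (space (M \<Otimes>\<^sub>M N)) Cs \<inter> space (stream_space M \<Otimes>\<^sub>M stream_space N)
       = scylinder (space M) As \<times> scylinder (space N) Bs"
      using scylinder_streams[of "space M" As, THEN subsetD] scylinder_streams[of "space N" Bs, THEN subsetD]
      unfolding AB(4) by (auto simp: space_pair_measure space_stream_space)
    then have "emeasure (distr (stream_space M \<Otimes>\<^sub>M stream_space N) (stream_space (M \<Otimes>\<^sub>M N))
         (\<lambda>(x, y). szip x y)) (scylinder (space (M \<Otimes>\<^sub>M N)) Cs) =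
       (\<Prod>A\<leftarrow>As. emeasure M A) * (\<Prod>B\<leftarrow>Bs. emeasure N B)"
      using AB by (subst emeasure_distr[OF measurable_szip dom[OF Cs]])
        (simp add: SN.emeasure_pair_measure_Times sets_scylinder M.emeasure_scylinder N.emeasure_scylinder)
    also have "\<dots> = (\<Prod>C\<leftarrow>Cs. emeasure (M \<Otimes>\<^sub>M N) C)"
      unfolding AB(4) using AB(1-3)
      by (induction As Bs rule: list_induct2) (auto simp: N.emeasure_pair_measure_Times ac_simps)
    also have "\<dots> = emeasure (stream_space (M \<Otimes>\<^sub>M N)) (scylinder (space (M \<Otimes>\<^sub>M N)) Cs)"
      using Cs by (subst MN.emeasure_scylinder) auto
    finally show ?thesis .
  qed
  show ?thesis
  proof (rule stream_space_eq_scylinder[where G="?G" and C="{space M \<times> space N}" and S="M \<Otimes>\<^sub>M N"])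
    show "prob_space (distr (stream_space M \<Otimes>\<^sub>M stream_space N) (stream_space (M \<Otimes>\<^sub>M N)) (\<lambda>(x, y). szip x y))"
      by (rule SMN.prob_space_distr[OF measurable_szip])
    show "prob_space (stream_space (M \<Otimes>\<^sub>M N))" by (rule MN.prob_space_stream_space)
    show "Int_stable ?G" by (rule Int_stable_pair_measure_generator)
    show "sets (M \<Otimes>\<^sub>M N) = sets (sigma (space (M \<Otimes>\<^sub>M N)) ?G)"
      by (simp add: sets_pair_measure space_pair_measure sets_measure_of_conv pair_measure_closed)
    show "?G \<subseteq> Pow (space (M \<Otimes>\<^sub>M N))"
      by (simp add: space_pair_measure pair_measure_closed)
  qed (use * in \<open>auto simp: space_pair_measure\<close>)
qed

text \<open>This splits the stream of triples into independent streams, so that Fubini can fix the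
  clocks before the uniform variables are drawn. By \<open>stream_space_pair\<close>, and because
  unzipping undoes zipping, the unzip map has the product measure as its law.\<close>

lemma AE_stream_space_pair:
  assumes M: "prob_space M" and N: "prob_space N"
  assumes P: "AE z in stream_space M \<Otimes>\<^sub>M stream_space N. P (fst z) (snd z)"
  shows "AE \<omega> in stream_space (M \<Otimes>\<^sub>M N). P (smap fst \<omega>) (smap snd \<omega>)"
proof -
  let ?\<phi> = "\<lambda>\<omega>. (smap fst \<omega>, smap snd \<omega>)"
  have [measurable]: "?\<phi> \<in> stream_space (M \<Otimes>\<^sub>M N) \<rightarrow>\<^sub>M stream_space M \<Otimes>\<^sub>M stream_space N"
    by measurable
  have id: "smap fst (szip x y) = x" "smap snd (szip x y) = y" for x :: "'a stream" and y :: "'b stream"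
    by (coinduction arbitrary: x y; auto)+
  have "distr (stream_space (M \<Otimes>\<^sub>M N)) (stream_space M \<Otimes>\<^sub>M stream_space N) ?\<phi> =
      distr (stream_space M \<Otimes>\<^sub>M stream_space N) (stream_space M \<Otimes>\<^sub>M stream_space N) (\<lambda>z. z)"
    by (subst stream_space_pair[OF M N, symmetric], subst distr_distr[OF _ measurable_szip])
      (auto simp: comp_def id split_beta)
  then have "AE z in distr (stream_space (M \<Otimes>\<^sub>M N)) (stream_space M \<Otimes>\<^sub>M stream_space N) ?\<phi>. P (fst z) (snd z)"
    using P by (simp only: distr_id2[OF refl])
  from AE_distrD[OF _ this] show ?thesis by simp
qed

text \<open>First-step analysis: condition on the head of the stream and argue about the tail, which
  has the same law.\<close>

lemma (in prob_space) AE_stream_space_StreamI: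
  assumes [measurable]: "Measurable.pred (stream_space M) P"
  assumes "AE x in M. AE X in stream_space M. P (x ## X)"
  shows "AE X in stream_space M. P X"
  using assms AE_stream_space by blast

section \<open>Exponential clocks\<close>

lemma prob_space_exp1: "prob_space exp1"
  unfolding exp1_def by (rule prob_space_exponential_density) simp

lemma sets_exp1 [measurable_cong]: "sets exp1 = sets borel"
  by (simp add: exp1_def)

lemma AE_exp1_pos: "AE x in exp1. 0 < x"
  unfolding exp1_def
  by (subst AE_density) (use AE_lborel_singleton[of 0] in \<open>auto simp: exponential_density_def elim!: eventually_mono\<close>)

lemma AE_exp1_neq: "AE x in exp1. x \<noteq> z"
  unfolding exp1_def
  by (subst AE_density) (use AE_lborel_singleton[of z] in \<open>auto elim!: eventually_mono\<close>)

lemma not_AE_exp1_less_1: "\<not> (AE x in exp1. x < 1)"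
proof
  assume "AE x in exp1. x < 1"
  then have "AE x in lborel. 0 < ennreal (exponential_density 1 x) \<longrightarrow> x < (1::real)"
    unfolding exp1_def by (subst (asm) AE_density) auto
  then have "AE x in lborel. x \<notin> {1..2::real}"
    by eventually_elim (auto simp: exponential_density_def)
  then have "{1..2::real} \<in> null_sets lborel"
    by (subst AE_iff_null_sets) auto
  then show False by (simp add: null_sets_def)
qed

text \<open>Let \<open>?N\<close> be the event that \<open>P\<close> never occurs. Conditioning on
  the first entry gives prob \<open>?N\<close> = prob \<open>?N\<close> * prob \<open>?Q\<close>,
  and prob \<open>?Q\<close> < 1 forces prob \<open>?N\<close> = 0.\<close>

lemma (in prob_space) AE_stream_ex:
  assumes [measurable]: "Measurable.pred M P" and P: "\<not> (AE x in M. \<not> P x)"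
  shows "AE X in stream_space M. \<exists>n. P (X !! n)"
proof -
  interpret S: prob_space "stream_space M" by (rule prob_space_stream_space)
  let ?N = "{X \<in> space (stream_space M). \<forall>n. \<not> P (X !! n)}"
  let ?Q = "{x \<in> space M. \<not> P x}"
  have [measurable]: "?N \<in> sets (stream_space M)" by measurable
  have *: "{X \<in> space (stream_space M). t ## X \<in> ?N} = (if t \<in> ?Q then ?N else {})" if "t \<in> space M" for t
    using that by (auto simp: stream_space_Stream Stream_snth split: nat.splits)
  have "emeasure (stream_space M) ?N =
      (\<integral>\<^sup>+t. emeasure (stream_space M) {X \<in> space (stream_space M). t ## X \<in> ?N} \<partial>M)"
    by (rule emeasure_stream_space) measurable
  also have "\<dots> = (\<integral>\<^sup>+t. emeasure (stream_space M) ?N * indicator ?Q t \<partial>M)"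
    by (intro nn_integral_cong) (simp only: *, auto split: split_indicator)
  also have "\<dots> = emeasure (stream_space M) ?N * emeasure M ?Q"
    by (rule nn_integral_cmult_indicator) measurable
  finally have eq: "S.prob ?N = S.prob ?N * prob ?Q"
    by (simp add: S.emeasure_eq_measure emeasure_eq_measure ennreal_mult'[symmetric])
  have "prob ?Q \<noteq> 1"
    using P by (subst prob_Collect_eq_1) auto
  with eq have "S.prob ?N = 0" by simp
  then show ?thesis
    by (subst AE_iff_measurable[OF _ refl]) (auto simp: S.emeasure_eq_measure)
qed

lemma (in prob_space) AE_stream_infinitely_often:
  assumes [measurable]: "Measurable.pred M P" and P: "\<not> (AE x in M. \<not> P x)"
  shows "AE X in stream_space M. \<forall>N. \<exists>n\<ge>N. P (X !! n)"
proof -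
  have "AE X in stream_space M. \<exists>n\<ge>N. P (X !! n)" for N
  proof (induction N)
    case 0
    then show ?case using AE_stream_ex[OF assms] by simp
  next
    case (Suc N)
    show ?case
    proof (rule AE_stream_space_StreamI)
      show "AE x in M. AE X in stream_space M. \<exists>n\<ge>Suc N. P ((x ## X) !! n)"
      proof (rule AE_I2)
        fix x
        show "AE X in stream_space M. \<exists>n\<ge>Suc N. P ((x ## X) !! n)"
          using Suc by eventually_elim (metis Suc_le_mono snth_Stream)
      qed
    qed measurable
  qed
  then show ?thesis by (simp add: AE_all_countable)
qed

section \<open>Ring times of the two clocks and the resulting order of the jumps\<close>

definition ring :: "real stream \<Rightarrow> nat \<Rightarrow> real" where
  "ring X k = (\<Sum>j\<le>k. X !! j)"

lemma measurable_ring [measurable]: "(\<lambda>X. ring X k) \<in> borel_measurable (stream_space borel)"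
  unfolding ring_def by measurable

lemma sets_stream_exp1 [measurable_cong]: "sets (stream_space exp1) = sets (stream_space borel)"
  by (rule sets_stream_space_cong) (rule sets_exp1)

text \<open>The target \<open>z\<close> is arbitrary so that the induction can remove the first
  waiting time and aim at \<open>z - x\<close>. With one clock fixed, its ring times serve as the
  values of \<open>z\<close>, which excludes ties between the clocks.\<close>

lemma AE_ring_neq: "AE X in stream_space exp1. ring X k \<noteq> z"
proof -
  interpret E: prob_space exp1 by (rule prob_space_exp1)
  show ?thesis
  proof (induction k arbitrary: z)
    case 0
    show ?case
    proof (rule E.AE_stream_space_StreamI)
      show "AE x in exp1. AE X in stream_space exp1. ring (x ## X) 0 \<noteq> z"
        using AE_exp1_neq[of z] by eventually_elim (simp add: ring_def)
    qed measurable
  next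
    case (Suc k)
    show ?case
    proof (rule E.AE_stream_space_StreamI)
      show "AE x in exp1. AE X in stream_space exp1. ring (x ## X) (Suc k) \<noteq> z"
      proof (rule AE_I2)
        fix x
        have "ring (x ## X) (Suc k) = x + ring X k" for X
          by (simp add: ring_def sum.atMost_Suc_shift del: sum.atMost_Suc)
        then show "AE X in stream_space exp1. ring (x ## X) (Suc k) \<noteq> z"
          using Suc[of "z - x"] by (auto elim!: eventually_mono)
      qed
    qed measurable
  qed
qed

text \<open>Divergence of the ring times is tested against natural numbers only, so that countably
  many conditions define the set and it is measurable.\<close>

definition regular_clock :: "real stream \<Rightarrow> bool" where
  "regular_clock X \<longleftrightarrow> (\<forall>j. 0 < X !! j) \<and> (\<forall>m::nat. \<exists>k. real m < ring X k)"

lemma measurable_regular_clock [measurable]: "Measurable.pred (stream_space borel) regular_clock"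
  unfolding regular_clock_def[abs_def] by measurable

text \<open>Infinitely many waiting times are at least 1, hence the ring times pass every natural
  number.\<close>

lemma AE_regular_clock: "AE X in stream_space exp1. regular_clock X"
proof -
  interpret E: prob_space exp1 by (rule prob_space_exp1)
  have "AE X in stream_space exp1. stream_all (\<lambda>x. 0 < x) X"
    by (rule E.AE_stream_all) (use AE_exp1_pos in measurable)
  moreover have "AE X in stream_space exp1. \<forall>N. \<exists>n\<ge>N. 1 \<le> X !! n"
    using not_AE_exp1_less_1 by (intro E.AE_stream_infinitely_often) (auto simp: not_le)
  ultimately show ?thesis
  proof eventually_elim
    case (elim X)
    then have pos: "0 < X !! j" for j by (simp add: stream_all_def)
    have mono: "ring X i \<le> ring X j" if "i \<le> j" for i j
      unfolding ring_def using that pos by (intro sum_mono2) (auto intro: less_imp_le)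
    have "\<exists>k. real m < ring X k" for m
    proof (induction m)
      case 0 show ?case using pos[of 0] by (intro exI[of _ 0]) (simp add: ring_def)
    next
      case (Suc m)
      then obtain k where k: "real m < ring X k" by blast
      obtain n where n: "n \<ge> Suc k" "1 \<le> X !! n" using elim by blast
      then obtain n' where n': "n = Suc n'" "k \<le> n'" by (cases n) auto
      then have "ring X n = ring X n' + X !! n" by (simp add: ring_def)
      then show ?case using n n' k mono[of k n'] by (intro exI[of _ n]) simp
    qed
    then show ?case using pos by (simp add: regular_clock_def)
  qed
qed

text \<open>Here \<open>c n\<close> will mean that jump number \<open>n\<close> is made by particle
  A. That both particles jump infinitely often is all that the meeting argument asks of the order of
  the jumps.\<close>

definition both_recur :: "(nat \<Rightarrow> bool) \<Rightarrow> bool" where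
  "both_recur c \<longleftrightarrow> (\<forall>N. (\<exists>n\<ge>N. c n) \<and> (\<exists>n\<ge>N. \<not> c n))"

text \<open>The numbers of rings already used by A and B. They depend on the clocks alone, neither
  on positions nor on weights, which is what allows conditioning on the order of the jumps.\<close>

primrec clock_counts :: "real stream \<Rightarrow> real stream \<Rightarrow> nat \<Rightarrow> nat \<times> nat" where
  "clock_counts X Y 0 = (0, 0)"
| "clock_counts X Y (Suc n) = (case clock_counts X Y n of (i, j) \<Rightarrow>
     if ring X i \<le> ring Y j then (Suc i, j) else (i, Suc j))"

definition A_jumps :: "real stream \<Rightarrow> real stream \<Rightarrow> nat \<Rightarrow> bool" where
  "A_jumps X Y n = (case clock_counts X Y n of (i, j) \<Rightarrow> ring X i \<le> ring Y j)"

lemma clock_counts_Suc: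
  "clock_counts X Y (Suc n) = (if A_jumps X Y n
     then (Suc (fst (clock_counts X Y n)), snd (clock_counts X Y n))
     else (fst (clock_counts X Y n), Suc (snd (clock_counts X Y n))))"
  by (simp add: A_jumps_def split: prod.split)

lemma clock_counts_sum: "fst (clock_counts X Y n) + snd (clock_counts X Y n) = n"
  by (induction n) (simp_all add: clock_counts_Suc del: clock_counts.simps(2))

lemma ring_Suc: "ring X (Suc k) = ring X k + X !! Suc k"
  by (simp add: ring_def)

lemma regular_clock_strict_mono:
  assumes "regular_clock X" "i < j"
  shows "ring X i < ring X j"
proof -
  have "strict_mono (ring X)"
    using assms(1) unfolding strict_mono_Suc_iff ring_Suc regular_clock_def
    by (simp del: snth.simps)
  then show ?thesis using assms(2) by (rule strict_monoD)
qed

lemma regular_clock_unbounded: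
  assumes "regular_clock X"
  obtains k where "T < ring X k"
proof -
  obtain m where "T < real m" using reals_Archimedean2 by blast
  moreover obtain k where "real m < ring X k" using assms unfolding regular_clock_def by blast
  ultimately show ?thesis using that[of k] by linarith
qed

text \<open>If one particle stopped jumping, its pending ring time would stay fixed and bound all
  later ring times of the other clock, contrary to their divergence.\<close>

lemma both_recur_A_jumps:
  assumes X: "regular_clock X" and Y: "regular_clock Y"
  shows "both_recur (A_jumps X Y)"
  unfolding both_recur_def
proof (intro allI conjI; rule ccontr)
  fix N
  let ?i = "fst (clock_counts X Y N)" and ?j = "snd (clock_counts X Y N)"
  {
    assume "\<not> (\<exists>n\<ge>N. A_jumps X Y n)"
    then have no: "\<not> A_jumps X Y n" if "n \<ge> N" for n using that by blast
    have cc: "clock_counts X Y (N + d) = (?i, ?j + d)" for d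
      by (induction d) (simp_all add: clock_counts_Suc no del: clock_counts.simps(2))
    have "ring Y (?j + d) < ring X ?i" for d
      using no[of "N + d"] unfolding A_jumps_def cc by simp
    moreover obtain k where "ring X ?i < ring Y k" using regular_clock_unbounded[OF Y] .
    moreover have "ring Y k < ring Y (?j + Suc k)" by (rule regular_clock_strict_mono[OF Y]) simp
    ultimately show False by (meson less_trans less_irrefl)
  }
  {
    assume "\<not> (\<exists>n\<ge>N. \<not> A_jumps X Y n)"
    then have no: "A_jumps X Y n" if "n \<ge> N" for n using that by blast
    have cc: "clock_counts X Y (N + d) = (?i + d, ?j)" for d
      by (induction d) (simp_all add: clock_counts_Suc no del: clock_counts.simps(2))
    have "ring X (?i + d) \<le> ring Y ?j" for d
      using no[of "N + d"] unfolding A_jumps_def cc by simp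
    moreover obtain k where "ring Y ?j < ring X k" using regular_clock_unbounded[OF X] .
    moreover have "ring X k < ring X (?i + Suc k)" by (rule regular_clock_strict_mono[OF X]) simp
    ultimately show False by (meson less_trans less_irrefl not_le)
  }
qed

text \<open>The time of the superposed clock after \<open>n\<close> jumps. The index is shifted:
  \<open>jump_time X Y (Suc n)\<close> is the time of the jump whose particle is given by
  \<open>A_jumps X Y n\<close>.\<close>

primrec jump_time :: "real stream \<Rightarrow> real stream \<Rightarrow> nat \<Rightarrow> real" where
  "jump_time X Y 0 = 0"
| "jump_time X Y (Suc n) = min (ring X (fst (clock_counts X Y n))) (ring Y (snd (clock_counts X Y n)))"

text \<open>Of the two pending rings the earlier one is used and replaced by a later ring of the
  same clock. The other is strictly later because there are no ties. So the minimum of the pending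
  rings increases strictly.\<close>

lemma jump_time_less_Suc:
  assumes X: "regular_clock X" and Y: "regular_clock Y" and ties: "\<And>i j. ring X i \<noteq> ring Y j"
  shows "jump_time X Y n < jump_time X Y (Suc n)"
proof (cases n)
  case 0
  have "0 < X !! 0" "0 < Y !! 0" using X Y unfolding regular_clock_def by blast+
  with 0 show ?thesis by (simp add: ring_def)
next
  case (Suc m)
  obtain i j where ij: "clock_counts X Y m = (i, j)" by fastforce
  show ?thesis
    using ties[of i j] regular_clock_strict_mono[OF X, of i "Suc i"] regular_clock_strict_mono[OF Y, of j "Suc j"]
    by (auto simp: Suc ij)
qed

lemma jump_time_strict_mono:
  assumes "regular_clock X" "regular_clock Y" "\<And>i j. ring X i \<noteq> ring Y j"
  shows "strict_mono (jump_time X Y)"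
  using jump_time_less_Suc[OF assms] by (simp only: strict_mono_Suc_iff) simp

lemma jump_time_ge_past_rings:
  assumes X: "regular_clock X" and Y: "regular_clock Y" and ties: "\<And>i j. ring X i \<noteq> ring Y j"
  shows "(\<forall>k<fst (clock_counts X Y n). ring X k \<le> jump_time X Y n) \<and>
         (\<forall>k<snd (clock_counts X Y n). ring Y k \<le> jump_time X Y n)"
proof (induction n)
  case (Suc n)
  have lt: "jump_time X Y n < jump_time X Y (Suc n)" by (rule jump_time_less_Suc[OF assms])
  show ?case
  proof (intro conjI allI impI)
    fix k assume k: "k < fst (clock_counts X Y (Suc n))"
    show "ring X k \<le> jump_time X Y (Suc n)"
    proof (cases "k < fst (clock_counts X Y n)")
      case True then show ?thesis using Suc lt by force
    next
      case False
      then show ?thesis using k by (auto split: prod.splits if_splits simp: less_Suc_eq)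
    qed
  next
    fix k assume k: "k < snd (clock_counts X Y (Suc n))"
    show "ring Y k \<le> jump_time X Y (Suc n)"
    proof (cases "k < snd (clock_counts X Y n)")
      case True then show ?thesis using Suc lt by force
    next
      case False
      then show ?thesis using k by (auto split: prod.splits if_splits simp: less_Suc_eq)
    qed
  qed
qed simp

text \<open>Pigeonhole: after \<open>Suc (i + j)\<close> jumps either A has used its ring
  \<open>i\<close> or B its ring \<open>j\<close>, and both of these exceed
  \<open>T\<close>.\<close>

lemma jump_time_unbounded:
  assumes X: "regular_clock X" and Y: "regular_clock Y" and ties: "\<And>i j. ring X i \<noteq> ring Y j"
  obtains n where "T < jump_time X Y n"
proof -
  obtain i where i: "T < ring X i" using regular_clock_unbounded[OF X] .
  obtain j where j: "T < ring Y j" using regular_clock_unbounded[OF Y] .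
  let ?n = "Suc (i + j)"
  have "i < fst (clock_counts X Y ?n) \<or> j < snd (clock_counts X Y ?n)"
    using clock_counts_sum[of X Y ?n] by linarith
  then show ?thesis
    using that[of ?n] jump_time_ge_past_rings[OF assms, of ?n] i j by force
qed

lemma measurable_clock_counts [measurable]:
  "(\<lambda>(X, Y). clock_counts X Y n) \<in> stream_space borel \<Otimes>\<^sub>M stream_space borel \<rightarrow>\<^sub>M count_space UNIV"
proof (induction n)
  case (Suc n)
  have *: "(\<lambda>(X, Y). clock_counts X Y (Suc n)) =
    (\<lambda>z. (\<lambda>ij z. if ring (fst z) (fst ij) \<le> ring (snd z) (snd ij) then (Suc (fst ij), snd ij) else (fst ij, Suc (snd ij)))
      ((\<lambda>(X, Y). clock_counts X Y n) z) z)"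
    by (auto simp: fun_eq_iff split: prod.split)
  show ?case unfolding *
    by (rule measurable_compose_countable[OF _ Suc]) measurable
qed simp

lemma measurable_A_jumps:
  "Measurable.pred (stream_space borel \<Otimes>\<^sub>M stream_space borel) (\<lambda>z. A_jumps (fst z) (snd z) n)"
proof -
  have *: "(\<lambda>z. A_jumps (fst z) (snd z) n) =
    (\<lambda>z. (\<lambda>ij z. ring (fst z) (fst ij) \<le> ring (snd z) (snd ij)) ((\<lambda>(X, Y). clock_counts X Y n) z) z)"
    by (auto simp: fun_eq_iff A_jumps_def split: prod.split)
  show ?thesis unfolding *
    by (rule measurable_compose_countable[OF _ measurable_clock_counts]) measurable
qed

section \<open>The resistance of the gap\<close>

lemma prob_space_unif01: "prob_space unif01"
  unfolding unif01_def by (rule prob_space_uniform_measure) auto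

lemma sets_unif01 [measurable_cong]: "sets unif01 = sets borel"
  by (simp add: unif01_def)

lemma nn_integral_unif01_threshold:
  assumes "0 \<le> p" "p \<le> 1"
  shows "(\<integral>\<^sup>+u. (if u < p then A else B) \<partial>unif01) = ennreal p * A + ennreal (1 - p) * B"
proof -
  interpret prob_space unif01 by (rule prob_space_unif01)
  have [simp]: "space unif01 = UNIV" by (simp add: unif01_def)
  have 1: "emeasure unif01 {..<p} = ennreal p"
  proof -
    have "{0..1} \<inter> {..<p} = {0..<p}" using assms by auto
    then show ?thesis by (simp add: unif01_def emeasure_uniform_measure assms divide_ennreal_def)
  qed
  have 2: "emeasure unif01 {p..} = ennreal (1 - p)"
  proof -
    have "{0..1} \<inter> {p..} = {p..1}" using assms by auto
    then show ?thesis by (simp add: unif01_def emeasure_uniform_measure assms divide_ennreal_def)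
  qed
  have "(\<integral>\<^sup>+u. (if u < p then A else B) \<partial>unif01)
      = (\<integral>\<^sup>+u. A * indicator {..<p} u + B * indicator {p..} u \<partial>unif01)"
    by (intro nn_integral_cong) (auto split: split_indicator)
  also have "\<dots> = A * emeasure unif01 {..<p} + B * emeasure unif01 {p..}"
    by (subst nn_integral_add) (auto simp: nn_integral_cmult_indicator)
  finally show ?thesis by (simp add: 1 2 mult.commute)
qed

lemma sets_stream_unif01 [measurable_cong]: "sets (stream_space unif01) = sets (stream_space borel)"
  by (rule sets_stream_space_cong) (rule sets_unif01)

text \<open>A configuration lists the positions of $A$ and $B$ and the edges traversed so far. Recording the
  traversed edges instead of the weights keeps the state space countable, which makes every function
  of the state measurable.\<close>
type_synonym config = "int \<times> int \<times> int list"

locale two_point_errw =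
  fixes \<Delta> a :: real
  assumes Delta_nonneg: "0 \<le> \<Delta>" and Delta_less_1: "\<Delta> < 1" and a_pos: "0 < a"
begin

section \<open>The process for a prescribed order of the jumps\<close>

definition weight :: "int list \<Rightarrow> int \<Rightarrow> real" where
  "weight cs v = a + real (count_list cs v)"

definition right_prob :: "int list \<Rightarrow> int \<Rightarrow> real" where
  "right_prob cs v = (weight cs v + \<Delta>) / (weight cs (v - 1) + weight cs v + \<Delta>)"

text \<open>The flag \<open>True\<close> moves A. An edge is named by its left endpoint, so a jump
  from v to v - 1 records v - 1.\<close>

fun hop :: "bool \<Rightarrow> config \<Rightarrow> real \<Rightarrow> config" where
  "hop True (x, y, cs) u =
    (if u < right_prob cs x then (x + 1, y, x # cs) else (x - 1, y, (x - 1) # cs))"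
| "hop False (x, y, cs) u =
    (if u < right_prob cs y then (x, y + 1, y # cs) else (x, y - 1, (y - 1) # cs))"

primrec path :: "(nat \<Rightarrow> bool) \<Rightarrow> config \<Rightarrow> real stream \<Rightarrow> nat \<Rightarrow> config" where
  "path c s \<omega> 0 = s"
| "path c s \<omega> (Suc n) = hop (c n) (path c s \<omega> n) (\<omega> !! n)"

lemma weight_Cons: "weight (e # cs) v = weight cs v + (if e = v then 1 else 0)"
  by (simp add: weight_def)

lemma weight_ge: "a \<le> weight cs v" by (simp add: weight_def)

lemma weight_pos: "0 < weight cs v" using weight_ge[of cs v] a_pos by linarith

lemma right_prob_bounds: "0 \<le> right_prob cs v" "right_prob cs v \<le> 1"
  using weight_pos[of cs v] weight_pos[of cs "v - 1"] Delta_nonneg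
  by (simp_all add: right_prob_def divide_simps)

lemma path_Stream: "path c s (u ## \<omega>) (Suc n) = path (\<lambda>k. c (Suc k)) (hop (c 0) s u) \<omega> n"
  by (induction n) simp_all

definition gap_resistance :: "config \<Rightarrow> real" where
  "gap_resistance = (\<lambda>(x, y, cs). \<Sum>v\<in>{x..<y}. 1 / weight cs v)"

lemma gap_resistance_nonneg: "0 \<le> gap_resistance s"
  using weight_pos by (cases s) (auto simp: gap_resistance_def intro!: sum_nonneg intro: less_imp_le)

text \<open>After an inward jump the traversed edge lies outside the gap, so its old term
  disappears. After an outward jump it enters the gap with its reinforced weight. No other term
  changes.\<close>

lemma
  assumes "x < y"
  shows gap_resistance_A_right: "gap_resistance (x + 1, y, x # cs) = gap_resistance (x, y, cs) - 1 / weight cs x"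
    and gap_resistance_A_left: "gap_resistance (x - 1, y, (x - 1) # cs) = gap_resistance (x, y, cs) + 1 / (weight cs (x - 1) + 1)"
    and gap_resistance_B_right: "gap_resistance (x, y + 1, y # cs) = gap_resistance (x, y, cs) + 1 / (weight cs y + 1)"
    and gap_resistance_B_left: "gap_resistance (x, y - 1, (y - 1) # cs) = gap_resistance (x, y, cs) - 1 / weight cs (y - 1)"
proof -
  have s: "{x..<y} = insert x {x + 1..<y}" "{x - 1..<y} = insert (x - 1) {x..<y}"
    "{x..<y + 1} = insert y {x..<y}" "{x..<y} = insert (y - 1) {x..<y - 1}"
    using assms by auto
  have c: "(\<Sum>v\<in>A. 1 / weight (e # cs) v) = (\<Sum>v\<in>A. 1 / weight cs v)" if "e \<notin> A" for e A
    using that by (intro sum.cong) (auto simp: weight_Cons)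
  show "gap_resistance (x + 1, y, x # cs) = gap_resistance (x, y, cs) - 1 / weight cs x"
    unfolding gap_resistance_def by (simp add: s(1) c)
  show "gap_resistance (x - 1, y, (x - 1) # cs) = gap_resistance (x, y, cs) + 1 / (weight cs (x - 1) + 1)"
    unfolding gap_resistance_def by (simp add: s(2) c weight_Cons)
  show "gap_resistance (x, y + 1, y # cs) = gap_resistance (x, y, cs) + 1 / (weight cs y + 1)"
    unfolding gap_resistance_def by (simp add: s(3) c weight_Cons)
  show "gap_resistance (x, y - 1, (y - 1) # cs) = gap_resistance (x, y, cs) - 1 / weight cs (y - 1)"
    unfolding gap_resistance_def by (simp add: s(4) c)
qed

text \<open>Chosen such that $\kappa$ times the probability of an outward jump over an untraversed edge is at
  most half the drift of the resistance.\<close>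
definition \<kappa> :: real where "\<kappa> = (1 - \<Delta>) / (2 * (a + 1)\<^sup>2)"

lemma kappa_pos: "0 < \<kappa>"
  using Delta_less_1 a_pos by (simp add: \<kappa>_def)

text \<open>Half of the exact expected decrease of the resistance at a jump of B. The other half is
  kept to pay for \<kappa>.\<close>

definition drift :: "int list \<Rightarrow> int \<Rightarrow> real" where
  "drift cs y = (1 - \<Delta>) / (2 * (weight cs y + 1) * (weight cs (y - 1) + weight cs y + \<Delta>))"

lemma drift_nonneg: "0 \<le> drift cs y"
  using weight_pos[of cs y] weight_pos[of cs "y - 1"] Delta_nonneg Delta_less_1
  by (simp add: drift_def)

text \<open>What the supermartingale inequality leaves to spare. Particle $A$ is the left one; the drift it
  produces is charged only when it jumps outward over an untraversed edge, which suffices.\<close>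
fun cost :: "bool \<Rightarrow> config \<Rightarrow> real \<Rightarrow> real" where
  "cost True (x, y, cs) u = (if \<not> u < right_prob cs x \<and> weight cs (x - 1) = a then \<kappa> else 0)"
| "cost False (x, y, cs) u = drift cs y + (if u < right_prob cs y \<and> weight cs y = a then \<kappa> else 0)"

lemma cost_nonneg: "0 \<le> cost b s u"
  using kappa_pos drift_nonneg by (cases "(b, s, u)" rule: cost.cases) auto

text \<open>Let w and z be the weights to the left and right of the jumping particle and S = w + z +
  \<Delta>. A jump of A lowers the resistance on average by at least 1 / ((w + 1) S), a jump of B by
  exactly (1 - \<Delta>) / ((z + 1) S). The additional terms fit into these amounts by the choice of
  \<kappa>.\<close>

lemma gap_resistance_drift:
  fixes x y :: int and cs :: "int list"
  assumes "x < y"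
  defines "s \<equiv> (x, y, cs)"
  defines "p \<equiv> right_prob cs x" and "q \<equiv> right_prob cs y"
  shows "p * gap_resistance (x + 1, y, x # cs)
      + (1 - p) * (gap_resistance (x - 1, y, (x - 1) # cs) + (if weight cs (x - 1) = a then \<kappa> else 0))
      \<le> gap_resistance s"
    and "q * (gap_resistance (x, y + 1, y # cs) + (if weight cs y = a then \<kappa> else 0))
      + (1 - q) * gap_resistance (x, y - 1, (y - 1) # cs) + drift cs y \<le> gap_resistance s"
proof -
  define w where "w = weight cs (x - 1)"
  define z where "z = weight cs x"
  define S where "S = w + z + \<Delta>"
  have pos: "0 < w" "0 < z" "0 < S" using weight_pos[of cs] Delta_nonneg
    by (simp_all add: w_def z_def S_def add_pos_pos add_pos_nonneg)
  have p: "p = (z + \<Delta>) / S" "1 - p = w / S"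
    using pos by (auto simp: p_def right_prob_def w_def z_def S_def field_simps)
  have 1: "(1 - p) * (if w = a then \<kappa> else 0) \<le> 1 / ((w + 1) * S)"
  proof (cases "w = a")
    case True
    have "\<kappa> * (w * (w + 1)) \<le> 1"
    proof -
      have "w * (w + 1) \<le> (a + 1)\<^sup>2" using True a_pos by (simp add: power2_eq_square)
      then have "\<kappa> * (w * (w + 1)) \<le> \<kappa> * (a + 1)\<^sup>2" using kappa_pos by simp
      also have "\<dots> = (1 - \<Delta>) / 2" using a_pos by (simp add: \<kappa>_def)
      also have "\<dots> \<le> 1" using Delta_nonneg by simp
      finally show ?thesis .
    qed
    then have "\<kappa> * (w * (w + 1)) / ((w + 1) * S) \<le> 1 / ((w + 1) * S)"
      using pos by (intro divide_right_mono) auto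
    moreover have "\<kappa> * (w * (w + 1)) / ((w + 1) * S) = (1 - p) * \<kappa>"
      using pos by (simp add: p(2))
    ultimately show ?thesis using True by simp
  qed (use pos in auto)
  \<comment> \<open>The drift points inward for A: p / z = (1 + \<Delta> / z) / S is at least 1 / S,
    while (1 - p) / (w + 1) is smaller than 1 / S by exactly 1 / ((w + 1) S).\<close>
  have 2: "p * (1 / z) - (1 - p) * (1 / (w + 1)) \<ge> 1 / ((w + 1) * S)"
  proof -
    have "p * (1 / z) \<ge> 1 / S" using pos Delta_nonneg by (simp add: p field_simps)
    moreover have "1 / S - (1 - p) * (1 / (w + 1)) = 1 / ((w + 1) * S)"
      using pos unfolding p(2) by (simp add: divide_simps)
    ultimately show ?thesis by linarith
  qed
  show "p * gap_resistance (x + 1, y, x # cs)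
      + (1 - p) * (gap_resistance (x - 1, y, (x - 1) # cs) + (if weight cs (x - 1) = a then \<kappa> else 0))
      \<le> gap_resistance s"
    using 1 2 unfolding gap_resistance_A_right[OF assms(1)] gap_resistance_A_left[OF assms(1)] s_def
      w_def[symmetric] z_def[symmetric]
    by (simp add: algebra_simps)
next
  define w where "w = weight cs (y - 1)"
  define z where "z = weight cs y"
  define S where "S = w + z + \<Delta>"
  have pos: "0 < w" "0 < z" "0 < S" using weight_pos[of cs] Delta_nonneg
    by (simp_all add: w_def z_def S_def add_pos_pos add_pos_nonneg)
  have q: "q = (z + \<Delta>) / S" "1 - q = w / S"
    using pos by (auto simp: q_def right_prob_def w_def z_def S_def field_simps)
  have d: "drift cs y = (1 - \<Delta>) / ((z + 1) * S) / 2"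
    by (simp add: drift_def w_def z_def S_def)
  have 1: "q * (if z = a then \<kappa> else 0) \<le> (1 - \<Delta>) / ((z + 1) * S) / 2"
  proof (cases "z = a")
    case True
    have "\<kappa> * ((z + \<Delta>) * (z + 1)) \<le> (1 - \<Delta>) / 2"
    proof -
      \<comment> \<open>This is where the square of a + 1 in \<kappa> comes from: an untraversed
        edge has weight a, and \<Delta> < 1.\<close>
      have "(z + \<Delta>) * (z + 1) \<le> (a + 1)\<^sup>2"
        unfolding True power2_eq_square using Delta_less_1 a_pos by (intro mult_right_mono) auto
      then have "\<kappa> * ((z + \<Delta>) * (z + 1)) \<le> \<kappa> * (a + 1)\<^sup>2" using kappa_pos by simp
      also have "\<dots> = (1 - \<Delta>) / 2" using a_pos by (simp add: \<kappa>_def)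
      finally show ?thesis .
    qed
    then have "\<kappa> * ((z + \<Delta>) * (z + 1)) / ((z + 1) * S) \<le> (1 - \<Delta>) / 2 / ((z + 1) * S)"
      using pos by (intro divide_right_mono) auto
    moreover have "\<kappa> * ((z + \<Delta>) * (z + 1)) / ((z + 1) * S) = q * \<kappa>"
      using pos by (simp add: q(1))
    ultimately show ?thesis using True by (simp add: mult_ac)
  qed (use pos Delta_less_1 in auto)
  \<comment> \<open>The drift points outward for B, and only the reinforcement compensates it: the
    numerator is (z + 1) - (z + \<Delta>).\<close>
  have 2: "(1 - q) * (1 / w) - q * (1 / (z + 1)) = (1 - \<Delta>) / ((z + 1) * S)"
    using pos unfolding q(1) by (simp add: divide_simps) (simp add: S_def algebra_simps)
  show "q * (gap_resistance (x, y + 1, y # cs) + (if weight cs y = a then \<kappa> else 0))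
      + (1 - q) * gap_resistance (x, y - 1, (y - 1) # cs) + drift cs y \<le> gap_resistance s"
  proof -
    define D K where "D = (1 - \<Delta>) / ((z + 1) * S)" and "K = (if z = a then \<kappa> else 0)"
    have "q * K \<le> D / 2" "(1 - q) * (1 / w) - q * (1 / (z + 1)) = D"
      using 1 2 by (simp_all only: D_def K_def)
    then have "q * (gap_resistance s + 1 / (z + 1) + K) + (1 - q) * (gap_resistance s - 1 / w) + D / 2
        \<le> gap_resistance s"
      by (simp add: algebra_simps)
    then show ?thesis
      unfolding gap_resistance_B_right[OF assms(1)] gap_resistance_B_left[OF assms(1)] d
        w_def[symmetric] z_def[symmetric] D_def[symmetric] K_def[symmetric] s_def[symmetric] .
  qed
qed

lemma measurable_hop [measurable]: "hop b s \<in> borel \<rightarrow>\<^sub>M count_space UNIV"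
proof -
  obtain x y cs where s: "s = (x, y, cs)" by (cases s)
  have "hop True s = (\<lambda>u. if u < right_prob cs x then (x + 1, y, x # cs) else (x - 1, y, (x - 1) # cs))"
    and "hop False s = (\<lambda>u. if u < right_prob cs y then (x, y + 1, y # cs) else (x, y - 1, (y - 1) # cs))"
    by (auto simp: s)
  then show ?thesis by (cases b) (simp_all only:, measurable)
qed

lemma measurable_cost [measurable]: "cost b s \<in> borel_measurable borel"
proof -
  obtain x y cs where s: "s = (x, y, cs)" by (cases s)
  have "cost True s = (\<lambda>u. if \<not> u < right_prob cs x \<and> weight cs (x - 1) = a then \<kappa> else 0)"
    and "cost False s = (\<lambda>u. drift cs y + (if u < right_prob cs y \<and> weight cs y = a then \<kappa> else 0))"
    by (auto simp: s)
  then show ?thesis by (cases b) (simp_all only:, measurable)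
qed

text \<open>As a function of \<open>u\<close> the integrand has only two values, separated by
  \<open>right_prob\<close>, so the integral is the weighted mean estimated in
  \<open>gap_resistance_drift\<close>.\<close>

lemma gap_resistance_supermartingale:
  assumes "fst s < fst (snd s)"
  shows "(\<integral>\<^sup>+u. ennreal (gap_resistance (hop b s u)) + ennreal (cost b s u) \<partial>unif01)
    \<le> ennreal (gap_resistance s)"
proof -
  obtain x y cs where s: "s = (x, y, cs)" by (cases s)
  have xy: "x < y" using assms s by simp
  note P = right_prob_bounds
  note nn = gap_resistance_nonneg drift_nonneg less_imp_le[OF kappa_pos]
  show ?thesis
  proof (cases b)
    case True
    define p where "p = right_prob cs x"
    have "(\<integral>\<^sup>+u. ennreal (gap_resistance (hop b s u)) + ennreal (cost b s u) \<partial>unif01) =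
      (\<integral>\<^sup>+u. (if u < p then ennreal (gap_resistance (x + 1, y, x # cs))
        else ennreal (gap_resistance (x - 1, y, (x - 1) # cs) + (if weight cs (x - 1) = a then \<kappa> else 0))) \<partial>unif01)"
      using nn by (intro nn_integral_cong) (auto simp: s True p_def)
    also have "\<dots> = ennreal (p * gap_resistance (x + 1, y, x # cs)
      + (1 - p) * (gap_resistance (x - 1, y, (x - 1) # cs) + (if weight cs (x - 1) = a then \<kappa> else 0)))"
      using nn P[of cs x] by (subst nn_integral_unif01_threshold)
       (auto simp: p_def ennreal_mult'[symmetric] ennreal_plus[symmetric] simp del: ennreal_plus)
    also have "\<dots> \<le> ennreal (gap_resistance s)"
      using gap_resistance_drift(1)[OF xy, of cs] unfolding s p_def by (rule ennreal_leI)
    finally show ?thesis .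
  next
    case False
    define p where "p = right_prob cs y"
    have "(\<integral>\<^sup>+u. ennreal (gap_resistance (hop b s u)) + ennreal (cost b s u) \<partial>unif01) =
      (\<integral>\<^sup>+u. (if u < p then ennreal (gap_resistance (x, y + 1, y # cs) + (if weight cs y = a then \<kappa> else 0) + drift cs y)
        else ennreal (gap_resistance (x, y - 1, (y - 1) # cs) + drift cs y)) \<partial>unif01)"
      using nn by (intro nn_integral_cong) (auto simp: s False p_def add_ac)
    also have "\<dots> = ennreal (p * (gap_resistance (x, y + 1, y # cs) + (if weight cs y = a then \<kappa> else 0) + drift cs y)
      + (1 - p) * (gap_resistance (x, y - 1, (y - 1) # cs) + drift cs y))"
      using nn P[of cs y] by (subst nn_integral_unif01_threshold)
       (auto simp: p_def ennreal_mult'[symmetric] ennreal_plus[symmetric] simp del: ennreal_plus)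
    also have "\<dots> \<le> ennreal (gap_resistance s)"
      using gap_resistance_drift(2)[OF xy, of cs] unfolding s p_def
      by (intro ennreal_leI) (simp add: algebra_simps)
    finally show ?thesis .
  qed
qed

section \<open>Expected total cost before the particles meet\<close>

lemma measurable_path [measurable]: "(\<lambda>\<omega>. path c s \<omega> n) \<in> stream_space borel \<rightarrow>\<^sub>M count_space UNIV"
proof (induction n)
  case (Suc n)
  note Suc [measurable]
  show ?case by simp
qed simp

lemma measurable_fun_path: "(\<lambda>\<omega>. g (path c s \<omega> n)) \<in> stream_space borel \<rightarrow>\<^sub>M count_space UNIV"
  by (rule measurable_compose[OF measurable_path]) (simp add: measurable_count_space_eq1)

text \<open>Charging stops as soon as the order of the particles fails, because the supermartingale
  inequality is available only for an ordered configuration.\<close>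

definition running_cost :: "(nat \<Rightarrow> bool) \<Rightarrow> config \<Rightarrow> real stream \<Rightarrow> nat \<Rightarrow> ennreal" where
  "running_cost c s \<omega> n = (if \<forall>k\<le>n. fst (path c s \<omega> k) < fst (snd (path c s \<omega> k))
     then ennreal (cost (c n) (path c s \<omega> n) (\<omega> !! n)) else 0)"

lemma measurable_running_cost [measurable]:
  "(\<lambda>\<omega>. running_cost c s \<omega> n) \<in> borel_measurable (stream_space borel)"
proof -
  have cost: "(\<lambda>\<omega>. cost (c n) (path c s \<omega> n) (\<omega> !! n)) \<in> borel_measurable (stream_space borel)"
    by (rule measurable_compose_countable[where f="\<lambda>s \<omega>. cost (c n) s (\<omega> !! n)"]; measurable)
  have ord: "Measurable.pred (stream_space borel) (\<lambda>\<omega>. fst (path c s \<omega> k) < fst (snd (path c s \<omega> k)))" for k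
    by (rule measurable_fun_path[of "\<lambda>s. fst s < fst (snd s)"])
  have "Measurable.pred (stream_space borel) (\<lambda>\<omega>. \<forall>k\<le>n. fst (path c s \<omega> k) < fst (snd (path c s \<omega> k)))"
    by (intro pred_intros_countable pred_intros_imp' ord)
  then show ?thesis unfolding running_cost_def
    by (rule measurable_If[OF measurable_compose[OF cost measurable_ennreal] borel_measurable_const predE])
qed

lemma running_cost_Stream:
  assumes "fst s < fst (snd s)"
  shows "running_cost c s (u ## \<omega>) 0 = ennreal (cost (c 0) s u)"
    and "running_cost c s (u ## \<omega>) (Suc n) = running_cost (\<lambda>k. c (Suc k)) (hop (c 0) s u) \<omega> n"
proof -
  have "(\<forall>k\<le>Suc n. fst (path c s (u ## \<omega>) k) < fst (snd (path c s (u ## \<omega>) k))) \<longleftrightarrow>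
     (\<forall>k\<le>n. fst (path (\<lambda>k. c (Suc k)) (hop (c 0) s u) \<omega> k) < fst (snd (path (\<lambda>k. c (Suc k)) (hop (c 0) s u) \<omega> k)))"
    (is "?L \<longleftrightarrow> ?R")
  proof
    assume ?L
    show ?R
    proof (intro allI impI)
      fix k assume "k \<le> n"
      with \<open>?L\<close>[rule_format, of "Suc k"] show "fst (path (\<lambda>k. c (Suc k)) (hop (c 0) s u) \<omega> k) < fst (snd (path (\<lambda>k. c (Suc k)) (hop (c 0) s u) \<omega> k))"
        by (simp only: path_Stream Suc_le_mono)
    qed
  next
    assume R: ?R
    show ?L
    proof (intro allI impI)
      fix k assume "k \<le> Suc n"
      with R assms show "fst (path c s (u ## \<omega>) k) < fst (snd (path c s (u ## \<omega>) k))"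
        by (cases k) (simp_all only: path_Stream Suc_le_mono path.simps(1))
    qed
  qed
  then show "running_cost c s (u ## \<omega>) (Suc n) = running_cost (\<lambda>k. c (Suc k)) (hop (c 0) s u) \<omega> n"
    unfolding running_cost_def path_Stream by (simp only: snth.simps stream.sel)
qed (use assms in \<open>simp add: running_cost_def\<close>)

lemma measurable_sum_running_cost:
  "(\<lambda>\<omega>. \<Sum>k<n. running_cost c s \<omega> k) \<in> borel_measurable (stream_space unif01)"
  by measurable

text \<open>Induction on the number of steps, for all \<open>c\<close> and \<open>s\<close> at once.
  After the first jump the expected remaining cost is at most the resistance of the new
  configuration, and \<open>gap_resistance_supermartingale\<close> absorbs the first cost.\<close>

lemma expected_running_cost:
  "(\<integral>\<^sup>+\<omega>. (\<Sum>k<n. running_cost c s \<omega> k) \<partial>stream_space unif01) \<le> ennreal (gap_resistance s)"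
proof (induction n arbitrary: c s)
  case (Suc n)
  interpret U: prob_space unif01 by (rule prob_space_unif01)
  interpret S: prob_space "stream_space unif01" by (rule U.prob_space_stream_space)
  show ?case
  proof (cases "fst s < fst (snd s)")
    case True
    let ?c = "\<lambda>k. c (Suc k)"
    have "(\<integral>\<^sup>+\<omega>. (\<Sum>k<Suc n. running_cost c s \<omega> k) \<partial>stream_space unif01) =
      (\<integral>\<^sup>+u. \<integral>\<^sup>+\<omega>. (\<Sum>k<Suc n. running_cost c s (u ## \<omega>) k) \<partial>stream_space unif01 \<partial>unif01)"
      by (rule U.nn_integral_stream_space[OF measurable_sum_running_cost])
    also have "\<dots> = (\<integral>\<^sup>+u. \<integral>\<^sup>+\<omega>. ennreal (cost (c 0) s u) +
         (\<Sum>k<n. running_cost ?c (hop (c 0) s u) \<omega> k) \<partial>stream_space unif01 \<partial>unif01)"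
      by (simp only: sum.lessThan_Suc_shift running_cost_Stream[OF True])
    also have "\<dots> = (\<integral>\<^sup>+u. ennreal (cost (c 0) s u) +
        (\<integral>\<^sup>+\<omega>. (\<Sum>k<n. running_cost ?c (hop (c 0) s u) \<omega> k) \<partial>stream_space unif01) \<partial>unif01)"
      by (simp add: nn_integral_add[OF borel_measurable_const measurable_sum_running_cost] S.emeasure_space_1)
    also have "\<dots> \<le> (\<integral>\<^sup>+u. ennreal (cost (c 0) s u) + ennreal (gap_resistance (hop (c 0) s u)) \<partial>unif01)"
      by (intro nn_integral_mono add_left_mono Suc)
    also have "\<dots> \<le> ennreal (gap_resistance s)"
      using gap_resistance_supermartingale[OF True] by (simp add: add.commute)
    finally show ?thesis .
  next
    case False
    then have "running_cost c s \<omega> k = 0" for \<omega> k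
      unfolding running_cost_def by (metis le0 path.simps(1))
    then show ?thesis by simp
  qed
qed simp

text \<open>Exchanging sum and integral bounds the expected total running cost by the initial
  resistance, so it is almost surely finite. On a path that stays ordered the running cost is the
  full cost.\<close>

lemma AE_total_cost_finite:
  "AE \<omega> in stream_space unif01.
     (\<forall>n. fst (path c s \<omega> n) < fst (snd (path c s \<omega> n)))
       \<longrightarrow> summable (\<lambda>n. cost (c n) (path c s \<omega> n) (\<omega> !! n))"
proof -
  have "(\<integral>\<^sup>+\<omega>. (\<Sum>k. running_cost c s \<omega> k) \<partial>stream_space unif01) =
    (\<Sum>k. \<integral>\<^sup>+\<omega>. running_cost c s \<omega> k \<partial>stream_space unif01)"
    by (rule nn_integral_suminf) measurable
  also have "\<dots> \<le> ennreal (gap_resistance s)"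
  proof (intro suminf_le_const summableI)
    fix n
    have "(\<Sum>k<n. \<integral>\<^sup>+\<omega>. running_cost c s \<omega> k \<partial>stream_space unif01) =
        (\<integral>\<^sup>+\<omega>. (\<Sum>k<n. running_cost c s \<omega> k) \<partial>stream_space unif01)"
      by (rule nn_integral_sum[symmetric]) measurable
    also have "\<dots> \<le> ennreal (gap_resistance s)" by (rule expected_running_cost)
    finally show "(\<Sum>k<n. \<integral>\<^sup>+\<omega>. running_cost c s \<omega> k \<partial>stream_space unif01) \<le> ennreal (gap_resistance s)" .
  qed
  finally have "(\<integral>\<^sup>+\<omega>. (\<Sum>k. running_cost c s \<omega> k) \<partial>stream_space unif01) \<noteq> \<infinity>"
    by (auto simp: top_unique)
  then have "AE \<omega> in stream_space unif01. (\<Sum>k. running_cost c s \<omega> k) \<noteq> \<infinity>"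
    by (rule nn_integral_noteq_infinite[rotated]) measurable
  then show ?thesis
  proof eventually_elim
    case (elim \<omega>)
    show ?case
    proof
      assume "\<forall>n. fst (path c s \<omega> n) < fst (snd (path c s \<omega> n))"
      then have "running_cost c s \<omega> k = ennreal (cost (c k) (path c s \<omega> k) (\<omega> !! k))" for k
        unfolding running_cost_def by simp
      with elim have "(\<Sum>k. ennreal (cost (c k) (path c s \<omega> k) (\<omega> !! k))) \<noteq> top"
        by (simp only: infinity_ennreal_def not_False_eq_True)
      then show "summable (\<lambda>n. cost (c n) (path c s \<omega> n) (\<omega> !! n))"
        by (intro summable_suminf_not_top cost_nonneg)
    qed
  qed
qed

section \<open>Recurrence\<close>

lemma weight_eq_a: "e \<notin> set cs \<Longrightarrow> weight cs e = a"
  by (simp add: weight_def count_notin)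

text \<open>A pathwise statement without probability: a path that stays ordered and on which B jumps
  infinitely often has infinite total cost.\<close>

lemma separated_path_infinite_cost:
  assumes ord: "\<And>n. fst (path c s \<omega> n) < fst (snd (path c s \<omega> n))"
    and inf: "\<And>N. \<exists>n\<ge>N. \<not> c n"
    and summ: "summable (\<lambda>n. cost (c n) (path c s \<omega> n) (\<omega> !! n))"
  shows False
proof -
  define X where "X n = fst (path c s \<omega> n)" for n
  define Y where "Y n = fst (snd (path c s \<omega> n))" for n
  define C where "C n = snd (snd (path c s \<omega> n))" for n
  define K where "K n = cost (c n) (path c s \<omega> n) (\<omega> !! n)" for n
  have path: "path c s \<omega> n = (X n, Y n, C n)" for n by (simp add: X_def Y_def C_def)
  have XY: "X n < Y n" for n using ord by (simp add: X_def Y_def)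
  have summK: "summable K" using summ by (simp add: K_def[abs_def])
  have K0: "0 \<le> K n" for n by (simp add: K_def cost_nonneg)
  have stepA: "Y (Suc n) = Y n \<and> (X (Suc n) = X n + 1 \<and> C (Suc n) = X n # C n \<or>
      X (Suc n) = X n - 1 \<and> C (Suc n) = (X n - 1) # C n \<and> (X n - 1 \<notin> set (C n) \<longrightarrow> \<kappa> \<le> K n))" if "c n" for n
  proof -
    have "(X (Suc n), Y (Suc n), C (Suc n)) = hop True (X n, Y n, C n) (\<omega> !! n)"
      using path[of "Suc n"] path[of n] that by simp
    moreover have "K n = cost True (X n, Y n, C n) (\<omega> !! n)"
      using path[of n] that by (simp add: K_def)
    ultimately show ?thesis by (auto simp: weight_eq_a split: if_splits)
  qed
  have stepB: "X (Suc n) = X n \<and> drift (C n) (Y n) \<le> K n \<and>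
     (Y (Suc n) = Y n + 1 \<and> C (Suc n) = Y n # C n \<and> (Y n \<notin> set (C n) \<longrightarrow> \<kappa> \<le> K n) \<or>
      Y (Suc n) = Y n - 1 \<and> C (Suc n) = (Y n - 1) # C n)" if "\<not> c n" for n
  proof -
    have "(X (Suc n), Y (Suc n), C (Suc n)) = hop False (X n, Y n, C n) (\<omega> !! n)"
      using path[of "Suc n"] path[of n] that by simp
    moreover have "K n = cost False (X n, Y n, C n) (\<omega> !! n)"
      using path[of n] that by (simp add: K_def)
    ultimately show ?thesis using kappa_pos drift_nonneg[of "C n" "Y n"]
      by (auto simp: weight_eq_a split: if_splits)
  qed

  \<comment> \<open>Summable costs tend to 0, so from \<open>N\<close> on no jump costs as much as
    \<kappa>, and outward jumps use traversed edges only.\<close>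
  have "\<forall>\<^sub>F n in sequentially. K n < \<kappa>"
    using summable_LIMSEQ_zero[OF summK] kappa_pos by (rule order_tendstoD(2))
  then obtain N where N: "\<And>n. n \<ge> N \<Longrightarrow> K n < \<kappa>" by (auto simp: eventually_sequentially)
  \<comment> \<open>The interval from \<open>m\<close> to \<open>M\<close> contains both particles
    and all edges traversed by time \<open>N\<close>; the edge \<open>e\<close> ends at
    \<open>e + 1\<close>. Inward jumps stay between the particles and outward ones on old edges, so
    the interval is never left.\<close>
  define M where "M = Max (insert (Y N) ((\<lambda>e. e + 1) ` set (C N)))"
  define m where "m = Min (insert (X N) (set (C N)))"
  have conf: "Y n \<le> M \<and> m \<le> X n \<and> (\<forall>e\<in>set (C n). m \<le> e \<and> e < M)" if "n \<ge> N" for n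
    using that
  proof (induction n rule: nat_induct_at_least)
    case base
    have "e + 1 \<le> M" if "e \<in> set (C N)" for e
      unfolding M_def using that by (intro Max_ge) auto
    moreover have "m \<le> e" if "e \<in> set (C N)" for e
      unfolding m_def using that by (intro Min_le) auto
    moreover have "Y N \<le> M" "m \<le> X N" by (simp_all add: M_def m_def)
    ultimately show ?case by force
  next
    case (Suc n)
    have k: "\<not> \<kappa> \<le> K n" using N[OF Suc.hyps] by simp
    show ?case
    proof (cases "c n")
      case True
      from stepA[OF True] k have d: "Y (Suc n) = Y n" "X (Suc n) = X n + 1 \<and> C (Suc n) = X n # C n \<or>
        X (Suc n) = X n - 1 \<and> C (Suc n) = (X n - 1) # C n \<and> X n - 1 \<in> set (C n)" by auto
      from d(2) show ?thesis using d(1) Suc.IH XY[of n] by auto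
    next
      case False
      from stepB[OF False] k have d: "X (Suc n) = X n" "Y (Suc n) = Y n + 1 \<and> C (Suc n) = Y n # C n \<and> Y n \<in> set (C n) \<or>
        Y (Suc n) = Y n - 1 \<and> C (Suc n) = (Y n - 1) # C n" by auto
      from d(2) show ?thesis using d(1) Suc.IH XY[of n] by auto
    qed
  qed

  \<comment> \<open>The least \<open>v\<close> with \<open>P v\<close> is the upper limit of the
    position of B. It exists because that position is eventually at most \<open>M\<close> and always
    above \<open>m\<close>.\<close>
  define P where "P v \<longleftrightarrow> (\<exists>N. \<forall>n\<ge>N. Y n \<le> v)" for v
  have "\<exists>v. P v \<and> \<not> P (v - 1)"
  proof (rule ccontr)
    assume "\<nexists>v. P v \<and> \<not> P (v - 1)"
    then have dec: "P v \<Longrightarrow> P (v - 1)" for v by blast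
    have "P M" unfolding P_def using conf by blast
    have "P k" if "k \<le> M" for k
      using that by (induction k rule: int_le_induct) (use \<open>P M\<close> dec in auto)
    then have "P (min M m)" by simp
    then obtain N' where N': "\<And>n. n \<ge> N' \<Longrightarrow> Y n \<le> min M m" unfolding P_def by blast
    show False using N'[of "max N N'"] conf[of "max N N'"] XY[of "max N N'"] by auto
  qed
  then obtain v N1 where N1: "\<And>n. n \<ge> N1 \<Longrightarrow> Y n \<le> v" and "\<not> P (v - 1)" unfolding P_def by blast
  have visit: "\<exists>n\<ge>k. Y n = v" for k
  proof -
    from \<open>\<not> P (v - 1)\<close> obtain n where "n \<ge> max N1 k" "\<not> Y n \<le> v - 1" unfolding P_def by blast
    then show ?thesis using N1[of n] by (intro exI[of _ n]) auto
  qed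

  \<comment> \<open>The denominator of the drift at \<open>v\<close>, with the return to
    \<open>v\<close> counted in advance while B is below \<open>v\<close>. Thus \<open>arg\<close>
    gains 2 when B leaves \<open>v\<close> and nothing when B comes back.\<close>
  define arg where "arg n = weight (C n) (v - 1) + weight (C n) v + \<Delta> + (if Y n < v then 1 else 0)" for n
  define w where "w = weight (C N1) v"
  have arg_pos: "0 < arg n" for n
    using weight_pos[of "C n" v] weight_pos[of "C n" "v - 1"] Delta_nonneg by (simp add: arg_def)
  \<comment> \<open>B never passes \<open>v\<close> any more, and A stays strictly below B before
    and after each jump. So only B can cross the edge from \<open>v - 1\<close> to \<open>v\<close>,
    and the edge to the right of \<open>v\<close> is left untouched.\<close>
  have stay: "weight (C (Suc n)) v = weight (C n) v \<and>
      arg (Suc n) = arg n + (if \<not> c n \<and> Y n = v then 2 else 0)" if n: "n \<ge> N1" for n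
  proof (cases "c n")
    case True
    from stepA[OF True] show ?thesis
      using N1[of n] N1[of "Suc n"] XY[of n] XY[of "Suc n"] n True
      by (auto simp: arg_def weight_Cons)
  next
    case False
    from stepB[OF False] show ?thesis
      using N1[of n] N1[of "Suc n"] XY[of n] XY[of "Suc n"] n False
      by (auto simp: arg_def weight_Cons)
  qed
  have w: "weight (C n) v = w" if "n \<ge> N1" for n
    using that by (induction n rule: nat_induct_at_least) (simp_all add: w_def stay)
  have w_pos: "0 < w" by (simp add: w_def weight_pos)
  \<comment> \<open>Chosen so that \<open>B * drift (C n) (Y n)\<close> equals
    \<open>2 / arg n\<close> when B is at \<open>v\<close>.\<close>
  define B where "B = 4 * (w + 1) / (1 - \<Delta>)"
  have B_pos: "0 < B" using w_pos Delta_less_1 by (simp add: B_def)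

  \<comment> \<open>The logarithm replaces the harmonic series: ln(1 + t) <= t with t =
    \<open>2 / arg n\<close> bounds each increment of \<open>ln (arg n)\<close> by a multiple of the
    cost. Summable costs therefore keep \<open>arg\<close> bounded.\<close>
  have ln_step: "ln (arg (Suc n)) \<le> ln (arg n) + B * K n" if n: "n \<ge> N1" for n
  proof (cases "\<not> c n \<and> Y n = v")
    case True
    have "arg (Suc n) = arg n * (1 + 2 / arg n)"
      using True stay[OF n] arg_pos[of n] by (simp add: field_simps)
    moreover have "0 < 1 + 2 / arg n" using arg_pos[of n] by (simp add: add_pos_pos)
    ultimately have "ln (arg (Suc n)) - ln (arg n) = ln (1 + 2 / arg n)"
      using arg_pos[of n] by (simp add: ln_mult_pos)
    also have "\<dots> \<le> 2 / arg n"
      using arg_pos[of n] by (intro ln_add_one_self_le_self) simp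
    also have "\<dots> = B * drift (C n) (Y n)"
    proof -
      have "drift (C n) (Y n) = (1 - \<Delta>) / (2 * (w + 1) * arg n)"
        using True by (simp add: drift_def w[OF n] arg_def)
      moreover have "4 * p / q * (q / (2 * p * r)) = 2 / r" if "p \<noteq> 0" "q \<noteq> 0" for p q r :: real
        using that by simp
      ultimately show ?thesis using Delta_less_1 w_pos by (simp add: B_def del: distrib_left_numeral)
    qed
    also have "\<dots> \<le> B * K n"
      using B_pos stepB[of n] True by (intro mult_left_mono) auto
    finally show ?thesis by simp
  next
    case False
    then have "arg (Suc n) = arg n" using stay[OF n] by auto
    then show ?thesis using B_pos K0[of n] by simp
  qed
  have ln_sum: "ln (arg n) \<le> ln (arg N1) + B * (\<Sum>k=N1..<n. K k)" if "n \<ge> N1" for n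
    using that
  proof (induction n rule: nat_induct_at_least)
    case (Suc n)
    then show ?case using ln_step[of n] by (simp add: algebra_simps)
  qed simp
  have "ln (arg n) \<le> ln (arg N1) + B * suminf K" if "n \<ge> N1" for n
  proof -
    have "(\<Sum>k=N1..<n. K k) \<le> suminf K"
      using sum_le_suminf[OF summK, of "{N1..<n}"] K0 by simp
    then have "B * (\<Sum>k=N1..<n. K k) \<le> B * suminf K" using B_pos by simp
    then show ?thesis using ln_sum[OF that] by linarith
  qed
  then have bounded: "arg n \<le> exp (ln (arg N1) + B * suminf K)" if "n \<ge> N1" for n
    using that arg_pos[of n] by (metis exp_le_cancel_iff exp_ln)

  \<comment> \<open>On the other hand \<open>arg\<close> is unbounded: after each visit of
    \<open>v\<close>, B remains there until its next jump \<open>n2\<close>, which increases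
    \<open>arg\<close> by 2.\<close>
  have "\<exists>n\<ge>N1. real j \<le> arg n" for j
  proof (induction j)
    case 0
    show ?case using arg_pos[of N1] by (intro exI[of _ N1]) simp
  next
    case (Suc j)
    then obtain n where n: "n \<ge> N1" "real j \<le> arg n" by blast
    obtain n1 where n1: "n1 \<ge> n" "Y n1 = v" using visit by blast
    define n2 where "n2 = (LEAST k. k \<ge> n1 \<and> \<not> c k)"
    have n2: "n2 \<ge> n1" "\<not> c n2"
      using LeastI_ex[OF inf[of n1]] by (simp_all add: n2_def)
    have cc: "c k" if "n1 \<le> k" "k < n2" for k
      using not_less_Least[of k "\<lambda>k. k \<ge> n1 \<and> \<not> c k"] that by (simp add: n2_def)
    have "k \<le> n2 \<longrightarrow> Y k = v" if "k \<ge> n1" for k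
      using that
    proof (induction k rule: nat_induct_at_least)
      case (Suc k) then show ?case using stepA[of k] cc[of k] by auto
    qed (use n1 in simp)
    then have Y2: "Y n2 = v" using n2 by simp
    have "arg n \<le> arg k" if "k \<ge> n" for k
      using that
    proof (induction k rule: nat_induct_at_least)
      case (Suc k) then show ?case using stay[of k] n by (auto split: if_splits)
    qed simp
    then have "arg n \<le> arg n2" using n1 n2 by simp
    moreover have "arg (Suc n2) = arg n2 + 2" using stay[of n2] n2 Y2 n1 n by simp
    ultimately show ?case using n n1 n2 by (intro exI[of _ "Suc n2"]) auto
  qed
  moreover obtain j where "exp (ln (arg N1) + B * suminf K) < real j" using reals_Archimedean2 by blast
  ultimately show False using bounded by (metis not_less order_trans)
qed

text \<open>Each step moves one particle by one site, so the particles cannot exchange their order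
  without meeting. If they never meet, the path stays ordered forever, and its cost would have to be
  both summable and infinite.\<close>

lemma AE_meet_ordered:
  assumes "fst s < fst (snd s)" and "\<And>N. \<exists>n\<ge>N. \<not> c n"
  shows "AE \<omega> in stream_space unif01. \<exists>n. fst (path c s \<omega> n) = fst (snd (path c s \<omega> n))"
  using AE_total_cost_finite[of c s]
proof eventually_elim
  case (elim \<omega>)
  show ?case
  proof (rule ccontr)
    assume ne: "\<nexists>n. fst (path c s \<omega> n) = fst (snd (path c s \<omega> n))"
    have "fst (path c s \<omega> n) < fst (snd (path c s \<omega> n))" for n
    proof (induction n)
      case (Suc n)
      obtain x y cs where p: "path c s \<omega> n = (x, y, cs)" by (cases "path c s \<omega> n")
      have "x < y" using Suc p by simp
      then have "fst (path c s \<omega> (Suc n)) \<le> fst (snd (path c s \<omega> (Suc n)))"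
        by (cases "c n") (auto simp: p)
      moreover have "fst (path c s \<omega> (Suc n)) \<noteq> fst (snd (path c s \<omega> (Suc n)))" using ne by blast
      ultimately show ?case by linarith
    qed (use assms in simp)
    with elim assms(2) separated_path_infinite_cost show False by blast
  qed
qed

section \<open>Meetings from an arbitrary configuration, infinitely often\<close>

fun swap_config :: "config \<Rightarrow> config" where "swap_config (x, y, cs) = (y, x, cs)"

text \<open>Exchanging the labels reduces the case in which B is the left particle to the ordered
  one.\<close>

lemma path_swap: "path c (swap_config s) \<omega> n = swap_config (path (\<lambda>k. \<not> c k) s \<omega> n)"
proof (induction n)
  case (Suc n)
  then show ?case
    by (cases "path (\<lambda>k. \<not> c k) s \<omega> n"; cases "c n") simp_all
qed simp

lemma AE_meet:
  assumes "both_recur c"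
  shows "AE \<omega> in stream_space unif01. \<exists>n. fst (path c s \<omega> n) = fst (snd (path c s \<omega> n))"
proof -
  obtain x y cs where s: "s = (x, y, cs)" by (cases s)
  consider "x < y" | "y < x" | "x = y" by linarith
  then show ?thesis
  proof cases
    case 1
    then show ?thesis using assms by (intro AE_meet_ordered) (auto simp: s both_recur_def)
  next
    case 2
    have sw: "s = swap_config (y, x, cs)" by (simp add: s)
    have "AE \<omega> in stream_space unif01. \<exists>n. fst (path (\<lambda>k. \<not> c k) (y, x, cs) \<omega> n) = fst (snd (path (\<lambda>k. \<not> c k) (y, x, cs) \<omega> n))"
      using 2 assms by (intro AE_meet_ordered) (auto simp: both_recur_def)
    then show ?thesis
    proof eventually_elim
      case (elim \<omega>)
      then obtain n where n: "fst (path (\<lambda>k. \<not> c k) (y, x, cs) \<omega> n) = fst (snd (path (\<lambda>k. \<not> c k) (y, x, cs) \<omega> n))" by blast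
      show ?case unfolding sw path_swap using n
        by (intro exI[of _ n], cases "path (\<lambda>k. \<not> c k) (y, x, cs) \<omega> n") simp
    qed
  next
    case 3
    then show ?thesis by (intro AE_I2 exI[of _ 0]) (simp add: s)
  qed
qed

text \<open>Induction on \<open>N\<close> by removing the first jump: what follows is again such a
  path, from another configuration and with a shifted order of jumps in which both particles still
  recur. Hence the generality in \<open>c\<close> and \<open>s\<close>.\<close>

lemma AE_meet_after:
  assumes "both_recur c"
  shows "AE \<omega> in stream_space unif01. \<exists>n\<ge>N. fst (path c s \<omega> n) = fst (snd (path c s \<omega> n))"
  using assms
proof (induction N arbitrary: c s)
  case 0
  then show ?case using AE_meet[of c s] by simp
next
  case (Suc N)
  interpret U: prob_space unif01 by (rule prob_space_unif01)
  have shift: "both_recur (\<lambda>k. c (Suc k))"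
    unfolding both_recur_def
  proof
    fix M
    from Suc.prems obtain i j where "i \<ge> Suc M" "c i" "j \<ge> Suc M" "\<not> c j"
      unfolding both_recur_def by meson
    then show "(\<exists>n\<ge>M. c (Suc n)) \<and> (\<exists>n\<ge>M. \<not> c (Suc n))"
      by (intro conjI exI[of _ "i - 1"] exI[of _ "j - 1"]) auto
  qed
  show ?case
  proof (rule U.AE_stream_space_StreamI)
    have "Measurable.pred (stream_space borel) (\<lambda>\<omega>. fst (path c s \<omega> n) = fst (snd (path c s \<omega> n)))" for n
      by (rule measurable_fun_path[of "\<lambda>s. fst s = fst (snd s)"])
    then have "Measurable.pred (stream_space borel) (\<lambda>\<omega>. \<exists>n\<ge>Suc N. fst (path c s \<omega> n) = fst (snd (path c s \<omega> n)))"
      by (intro pred_intros_countable pred_intros_conj1')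
    then show "Measurable.pred (stream_space unif01) (\<lambda>\<omega>. \<exists>n\<ge>Suc N. fst (path c s \<omega> n) = fst (snd (path c s \<omega> n)))"
      by (simp only: measurable_cong_sets[OF sets_stream_unif01 refl])
    show "AE u in unif01. AE \<omega> in stream_space unif01.
        \<exists>n\<ge>Suc N. fst (path c s (u ## \<omega>) n) = fst (snd (path c s (u ## \<omega>) n))"
    proof (rule AE_I2)
      fix u
      from Suc.IH[OF shift, of "hop (c 0) s u"]
      show "AE \<omega> in stream_space unif01. \<exists>n\<ge>Suc N. fst (path c s (u ## \<omega>) n) = fst (snd (path c s (u ## \<omega>) n))"
      proof eventually_elim
        case (elim \<omega>)
        then obtain n where "n \<ge> N" "fst (path c s (u ## \<omega>) (Suc n)) = fst (snd (path c s (u ## \<omega>) (Suc n)))"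
          unfolding path_Stream by blast
        then show ?case by (intro exI[of _ "Suc n"]) (simp del: path.simps)
      qed
    qed
  qed
qed

lemma AE_meet_infinitely_often:
  assumes "both_recur c"
  shows "AE \<omega> in stream_space unif01. \<forall>N. \<exists>n\<ge>N. fst (path c s \<omega> n) = fst (snd (path c s \<omega> n))"
  using AE_meet_after[OF assms] by (simp add: AE_all_countable)

section \<open>Integrating over the clocks\<close>

lemma measurable_path_clocks:
  "(\<lambda>z. path (A_jumps (fst z) (fst (snd z))) s (snd (snd z)) n)
     \<in> stream_space borel \<Otimes>\<^sub>M (stream_space borel \<Otimes>\<^sub>M stream_space borel) \<rightarrow>\<^sub>M count_space UNIV"
proof (induction n)
  case (Suc n)
  have J: "(\<lambda>z. A_jumps (fst z) (fst (snd z)) n)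
     \<in> stream_space borel \<Otimes>\<^sub>M (stream_space borel \<Otimes>\<^sub>M (stream_space borel :: real stream measure)) \<rightarrow>\<^sub>M count_space UNIV"
    using measurable_compose[OF _ measurable_A_jumps[of n],
        of "\<lambda>z. (fst z, fst (snd z))" "stream_space borel \<Otimes>\<^sub>M (stream_space borel \<Otimes>\<^sub>M (stream_space borel :: real stream measure))"]
    by simp
  have "(\<lambda>z. hop b t (snd (snd z) !! n))
     \<in> stream_space borel \<Otimes>\<^sub>M (stream_space borel \<Otimes>\<^sub>M stream_space borel) \<rightarrow>\<^sub>M count_space UNIV" for b t
    by measurable
  from measurable_compose_countable[OF this Suc]
  have "(\<lambda>z. hop b (path (A_jumps (fst z) (fst (snd z))) s (snd (snd z)) n) (snd (snd z) !! n))
     \<in> stream_space borel \<Otimes>\<^sub>M (stream_space borel \<Otimes>\<^sub>M stream_space borel) \<rightarrow>\<^sub>M count_space UNIV" for b .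
  from measurable_compose_countable[OF this J] show ?case by (simp only: path.simps)
qed simp

definition good_run :: "config \<Rightarrow> real stream \<Rightarrow> real stream \<Rightarrow> real stream \<Rightarrow> bool" where
  "good_run s X Y U \<longleftrightarrow> regular_clock X \<and> regular_clock Y \<and> (\<forall>i j. ring X i \<noteq> ring Y j) \<and>
     (\<forall>N. \<exists>n\<ge>N. fst (path (A_jumps X Y) s U n) = fst (snd (path (A_jumps X Y) s U n)))"

lemma measurable_good_run:
  "Measurable.pred (stream_space borel \<Otimes>\<^sub>M (stream_space borel \<Otimes>\<^sub>M stream_space borel))
     (\<lambda>z. good_run s (fst z) (fst (snd z)) (snd (snd z)))"
proof -
  let ?M = "stream_space borel \<Otimes>\<^sub>M (stream_space borel \<Otimes>\<^sub>M (stream_space borel :: real stream measure))"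
  have "Measurable.pred ?M (\<lambda>z. (\<lambda>t. fst t = fst (snd t)) (path (A_jumps (fst z) (fst (snd z))) s (snd (snd z)) n))" for n
    by (rule measurable_compose[OF measurable_path_clocks]) (simp add: measurable_count_space_eq1)
  then have "Measurable.pred ?M (\<lambda>z. \<forall>N. \<exists>n\<ge>N. fst (path (A_jumps (fst z) (fst (snd z))) s (snd (snd z)) n)
       = fst (snd (path (A_jumps (fst z) (fst (snd z))) s (snd (snd z)) n)))"
    by (intro pred_intros_countable pred_intros_conj1')
  moreover have "Measurable.pred ?M (\<lambda>z. regular_clock (fst z))"
    "Measurable.pred ?M (\<lambda>z. regular_clock (fst (snd z)))"
    "Measurable.pred ?M (\<lambda>z. \<forall>i j. ring (fst z) i \<noteq> ring (fst (snd z)) j)"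
    by measurable
  ultimately show ?thesis unfolding good_run_def by (intro pred_intros_logic)
qed

text \<open>Fubini in the order X, Y, U. For fixed X the ring times of A are constants, which Y
  avoids almost surely. For fixed clocks the order of the jumps is deterministic and
  \<open>AE_meet_infinitely_often\<close> applies. Since the noise is a stream of nested pairs,
  \<open>AE_stream_space_pair\<close> is applied twice.\<close>

lemma AE_good_run:
  "AE \<omega> in errw_space. good_run s (smap fst \<omega>) (smap fst (smap snd \<omega>)) (smap snd (smap snd \<omega>))"
proof -
  interpret E: prob_space exp1 by (rule prob_space_exp1)
  interpret U: prob_space unif01 by (rule prob_space_unif01)
  interpret EU: pair_prob_space exp1 unif01 ..
  interpret SE: prob_space "stream_space exp1" by (rule E.prob_space_stream_space)
  interpret SU: prob_space "stream_space unif01" by (rule U.prob_space_stream_space)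
  interpret SEU: prob_space "stream_space (exp1 \<Otimes>\<^sub>M unif01)" by (rule EU.prob_space_stream_space)
  interpret P1: pair_prob_space "stream_space exp1" "stream_space (exp1 \<Otimes>\<^sub>M unif01)" ..
  interpret P2: pair_prob_space "stream_space exp1" "stream_space unif01" ..
  have AE3: "AE U in stream_space unif01. good_run s X Y U"
    if "regular_clock X" "regular_clock Y" "\<forall>i j. ring Y j \<noteq> ring X i" for X Y
  proof -
    have "\<forall>i j. ring X i \<noteq> ring Y j" using that(3) by metis
    with AE_meet_infinitely_often[OF both_recur_A_jumps[OF that(1,2)], of s] that(1,2)
    show ?thesis by (auto simp: good_run_def elim!: eventually_mono)
  qed
  have AE2: "AE z in stream_space exp1 \<Otimes>\<^sub>M stream_space unif01. good_run s X (fst z) (snd z)"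
    if X: "regular_clock X" for X
  proof -
    have "AE Y in stream_space exp1. \<forall>i j. ring Y j \<noteq> ring X i"
      by (intro AE_all_countable[THEN iffD2] allI AE_ring_neq)
    with AE_regular_clock have "AE Y in stream_space exp1. AE U in stream_space unif01. good_run s X Y U"
      by eventually_elim (use X AE3 in blast)
    moreover have "Measurable.pred (stream_space exp1 \<Otimes>\<^sub>M stream_space unif01) (\<lambda>z. good_run s X (fst z) (snd z))"
    proof -
      have "(\<lambda>z. (X, fst z, snd z)) \<in> stream_space exp1 \<Otimes>\<^sub>M stream_space unif01 \<rightarrow>\<^sub>M
         stream_space borel \<Otimes>\<^sub>M (stream_space borel \<Otimes>\<^sub>M stream_space borel)"
        by (measurable; simp add: space_stream_space)
      from measurable_compose[OF this measurable_good_run] show ?thesis by simp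
    qed
    ultimately show ?thesis
      by (intro P2.AE_pair_measure) (simp_all add: pred_def)
  qed
  have "AE W in stream_space (exp1 \<Otimes>\<^sub>M unif01). good_run s X (smap fst W) (smap snd W)"
    if "regular_clock X" for X
    by (rule AE_stream_space_pair[OF prob_space_exp1 prob_space_unif01 AE2[OF that]])
  with AE_regular_clock
  have "AE X in stream_space exp1. AE W in stream_space (exp1 \<Otimes>\<^sub>M unif01). good_run s X (smap fst W) (smap snd W)"
    by (auto elim!: eventually_mono)
  moreover have "Measurable.pred (stream_space exp1 \<Otimes>\<^sub>M stream_space (exp1 \<Otimes>\<^sub>M unif01))
      (\<lambda>z. good_run s (fst z) (smap fst (snd z)) (smap snd (snd z)))"
  proof -
    have "(\<lambda>z. (fst z, smap fst (snd z), smap snd (snd z))) \<in> stream_space exp1 \<Otimes>\<^sub>M stream_space (exp1 \<Otimes>\<^sub>M unif01) \<rightarrow>\<^sub>M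
       stream_space borel \<Otimes>\<^sub>M (stream_space borel \<Otimes>\<^sub>M stream_space borel)"
      by measurable
    from measurable_compose[OF this measurable_good_run] show ?thesis by simp
  qed
  ultimately have "AE z in stream_space exp1 \<Otimes>\<^sub>M stream_space (exp1 \<Otimes>\<^sub>M unif01).
      good_run s (fst z) (smap fst (snd z)) (smap snd (snd z))"
    by (intro P1.AE_pair_measure) (simp_all add: pred_def)
  from AE_stream_space_pair[OF prob_space_exp1 EU.prob_space_axioms, where P="\<lambda>X W. good_run s X (smap fst W) (smap snd W)", OF this]
  show ?thesis unfolding errw_space_def .
qed

section \<open>Identification with the explicit construction\<close>

lemma move_weight:
  "move \<Delta> (weight cs) v u = (if u < right_prob cs v then (v + 1, weight (v # cs)) else (v - 1, weight ((v - 1) # cs)))"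
  by (auto simp: move_def right_prob_def weight_Cons fun_eq_iff)

text \<open>The list of traversed edges determines the weights, and the ring counters and jump times
  come from the clocks alone, so the chain splits into \<open>path\<close> and the clock
  functions.\<close>

lemma errw_chain_eq_path:
  fixes \<omega> l0 r0
  defines "X \<equiv> smap fst \<omega>" and "Y \<equiv> smap fst (smap snd \<omega>)" and "U \<equiv> smap snd (smap snd \<omega>)"
  shows "(case path (A_jumps X Y) (l0, r0, []) U n of (x, y, cs) \<Rightarrow>
     errw_chain \<Delta> a l0 r0 \<omega> n = \<lparr>posA = x, posB = y, wt = weight cs,
       cntA = fst (clock_counts X Y n), cntB = snd (clock_counts X Y n), jtime = jump_time X Y n\<rparr>)"
proof (induction n)
  case 0
  show ?case by (simp add: weight_def fun_eq_iff)
next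
  case (Suc n)
  obtain x y cs where p: "path (A_jumps X Y) (l0, r0, []) U n = (x, y, cs)"
    by (cases "path (A_jumps X Y) (l0, r0, []) U n")
  obtain i j where c: "clock_counts X Y n = (i, j)" by fastforce
  have r: "ringA \<omega> k = ring X k" "ringB \<omega> k = ring Y k" "unifU \<omega> k = U !! k" for k
    by (simp_all add: ringA_def ringB_def unifU_def ring_def X_def Y_def U_def)
  have "errw_chain \<Delta> a l0 r0 \<omega> n = \<lparr>posA = x, posB = y, wt = weight cs,
       cntA = i, cntB = j, jtime = jump_time X Y n\<rparr>"
    using Suc p c by simp
  moreover have "A_jumps X Y n \<longleftrightarrow> ring X i \<le> ring Y j" by (simp add: A_jumps_def c)
  ultimately show ?case
    by (cases "ring X i \<le> ring Y j")
      (auto simp: errw_step_def r p c move_weight Let_def)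
qed

end

theorem theorem1:
  fixes \<Delta> a :: real and l0 r0 :: int
  assumes "0 \<le> \<Delta>" and "\<Delta> < 1" and "0 < a" and "l0 < r0"
  shows "AE \<omega> in errw_space.
           \<forall>T. \<exists>t\<ge>T. t \<ge> 0 \<and> lpos \<Delta> a l0 r0 \<omega> t = rpos \<Delta> a l0 r0 \<omega> t"
proof -
  interpret two_point_errw \<Delta> a by unfold_locales fact+
  show ?thesis
    using AE_good_run[of "(l0, r0, [])"]
  proof eventually_elim
    case (elim \<omega>)
    define X Y U where "X = smap fst \<omega>" and "Y = smap fst (smap snd \<omega>)" and "U = smap snd (smap snd \<omega>)"
    let ?p = "path (A_jumps X Y) (l0, r0, []) U"
    from elim have reg: "regular_clock X" "regular_clock Y" "\<And>i j. ring X i \<noteq> ring Y j"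
      and meet: "\<And>N. \<exists>n\<ge>N. fst (?p n) = fst (snd (?p n))"
      unfolding good_run_def X_def Y_def U_def by blast+
    have chain: "posA (errw_chain \<Delta> a l0 r0 \<omega> n) = fst (?p n)"
      "posB (errw_chain \<Delta> a l0 r0 \<omega> n) = fst (snd (?p n))"
      "jtime (errw_chain \<Delta> a l0 r0 \<omega> n) = jump_time X Y n" for n
      using errw_chain_eq_path[where \<omega>=\<omega> and n=n and ?l0.0=l0 and ?r0.0=r0] by (auto simp: X_def Y_def U_def split: prod.splits)
    note mono = jump_time_strict_mono[OF reg]
    show ?case
    proof
      fix T
      obtain N where N: "T < jump_time X Y N" using jump_time_unbounded[OF reg] .
      obtain n where n: "n \<ge> N" "fst (?p n) = fst (snd (?p n))" using meet by blast
      let ?t = "jump_time X Y n"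
      have "T \<le> ?t" using N strict_mono_less_eq[OF mono, of N n] n(1) by linarith
      moreover have "0 \<le> ?t" using strict_mono_less_eq[OF mono, of 0 n] by simp
      \<comment> \<open>By strict monotonicity of the jump times, the state at the time of the
        \<open>n\<close>-th jump is the one right after that jump, so a meeting of the chain at
        index \<open>n\<close> is a meeting at time \<open>?t\<close>.\<close>
      moreover have "(LEAST m. ?t < jump_time X Y (Suc m)) = n"
        by (rule Least_equality) (simp_all add: strict_mono_less[OF mono] del: jump_time.simps)
      then have "errw_at \<Delta> a l0 r0 \<omega> ?t = errw_chain \<Delta> a l0 r0 \<omega> n"
        unfolding errw_at_def chain by simp
      then have "lpos \<Delta> a l0 r0 \<omega> ?t = rpos \<Delta> a l0 r0 \<omega> ?t"
        unfolding lpos_def rpos_def using chain n(2) by simp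
      ultimately show "\<exists>t\<ge>T. t \<ge> 0 \<and> lpos \<Delta> a l0 r0 \<omega> t = rpos \<Delta> a l0 r0 \<omega> t" by blast
    qed
  qed
qed

end
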